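(* Let $H$ be a complex separable Hilbert space and let $L\colon \operatorname{Dom}(L)\subset H\to H$ be a (densely defined) self-adjoint linear operator such that (a) $0=\inf\sigma_e(L)$, where $\sigma_e(L)$ is the essential spectrum of $L$; (b) $(-\delta,0)\subset\rho(L)$ for some $\delta>0$; (c) $\inf\sigma(L)=-\gamma$ for some (finite) $\gamma\geqslant0$. Let $h\in H$ and let $\phi\colon[0,+\infty)\to[0,+\infty)$ be continuous and such that (i) $\displaystyle\lim_{t\to+\infty}\frac{\phi(t)^2}{t}=0$, (ii) $\displaystyle\liminf_{t\to+\infty}\phi(t)>\|h\|$. Define $N(u)=\phi(\|u\|)P_B(u)$ for $u\in H$, where $P_B(u)=u$ if $\|u\|\leqslant1$ and $P_B(u)=u/\|u\|$ if $\|u\|>1$. Then the equation $Lu+N(u)=h$ has a solution $u\in\operatorname{Dom}(L)$.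
   Context: The essential spectrum of a self-adjoint $L$ is the set of $\lambda\in\sigma(L)$ that are accumulation points of $\sigma(L)$ or eigenvalues of infinite multiplicity; $\rho(L)$ is the resolvent set. $P_B$ is the metric projection onto the closed unit ball. *)

theory Defs
  imports "HOL-Analysis.Analysis"
begin

text \<open>
  Complex inner product spaces, built on top of the real ones: norm, metric and topology are those
  of the underlying real inner product space, whose inner product is the real part of the
  complex one. The product \<open>cinner\<close> is linear in the first and conjugate-linear in the second
  argument. Positive definiteness is inherited, since \<open>cinner x x\<close> is real by conjugate symmetry
  and has real part \<open>inner x x\<close>.
\<close>

class complex_inner = real_inner +
  fixes scaleC :: "complex \<Rightarrow> 'a \<Rightarrow> 'a"  (infixr "*\<^sub>C" 75)
    and cinner :: "'a \<Rightarrow> 'a \<Rightarrow> complex"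
  assumes scaleC_add_right: "a *\<^sub>C (x + y) = a *\<^sub>C x + a *\<^sub>C y"
    and scaleC_add_left: "(a + b) *\<^sub>C x = a *\<^sub>C x + b *\<^sub>C x"
    and scaleC_scaleC: "a *\<^sub>C (b *\<^sub>C x) = (a * b) *\<^sub>C x"
    and scaleC_of_real: "complex_of_real r *\<^sub>C x = r *\<^sub>R x"
    and cinner_commute: "cinner x y = cnj (cinner y x)"
    and cinner_add_left: "cinner (x + y) z = cinner x z + cinner y z"
    and cinner_scaleC_left: "cinner (a *\<^sub>C x) y = a * cinner x y"
    and Re_cinner: "Re (cinner x y) = inner x y"

class chilbert_space = complex_inner + complete_space

global_interpretation complex_vector:
  vector_space "scaleC :: complex \<Rightarrow> 'a \<Rightarrow> 'a::complex_inner"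
proof
  fix x :: 'a
  show "1 *\<^sub>C x = x"
    using scaleC_of_real[of 1 x] by simp
qed (simp_all add: scaleC_add_right scaleC_add_left scaleC_scaleC)

lemma cinner_self: "cinner x x = complex_of_real ((norm x)\<^sup>2)"
proof (rule complex_eqI)
  show "Re (cinner x x) = Re (complex_of_real ((norm x)\<^sup>2))"
    by (simp add: Re_cinner power2_norm_eq_inner)
  have "Im (cinner x x) = - Im (cinner x x)"
    by (subst cinner_commute) simp
  then show "Im (cinner x x) = Im (complex_of_real ((norm x)\<^sup>2))"
    by simp
qed

instantiation complex :: chilbert_space
begin

definition scaleC_complex :: "complex \<Rightarrow> complex \<Rightarrow> complex"
  where "scaleC_complex a x = a * x"

definition cinner_complex :: "complex \<Rightarrow> complex \<Rightarrow> complex"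
  where "cinner_complex x y = x * cnj y"

instance
  by standard
    (simp_all add: scaleC_complex_def cinner_complex_def inner_complex_def algebra_simps
      scaleR_conv_of_real)

end

text \<open>
  An unbounded operator with domain \<open>D\<close> is a pair of a set \<open>D\<close> and a total function \<open>L\<close>;
  the values of \<open>L\<close> outside \<open>D\<close> are irrelevant to all notions below.
\<close>

definition linear_operator_on :: "'a::complex_inner set \<Rightarrow> ('a \<Rightarrow> 'a) \<Rightarrow> bool"
  where "linear_operator_on D L \<longleftrightarrow>
    complex_vector.subspace D \<and>
    (\<forall>u\<in>D. \<forall>v\<in>D. L (u + v) = L u + L v) \<and>
    (\<forall>c. \<forall>u\<in>D. L (c *\<^sub>C u) = c *\<^sub>C L u)"

definition adjoint_domain :: "'a::complex_inner set \<Rightarrow> ('a \<Rightarrow> 'a) \<Rightarrow> 'a set"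
  where "adjoint_domain D L = {v. \<exists>w. \<forall>u\<in>D. cinner (L u) v = cinner u w}"

text \<open>The vector \<open>w\<close> is unique when \<open>D\<close> is dense.\<close>

definition adjoint_operator :: "'a::complex_inner set \<Rightarrow> ('a \<Rightarrow> 'a) \<Rightarrow> 'a \<Rightarrow> 'a"
  where "adjoint_operator D L v = (THE w. \<forall>u\<in>D. cinner (L u) v = cinner u w)"

definition self_adjoint :: "'a::complex_inner set \<Rightarrow> ('a \<Rightarrow> 'a) \<Rightarrow> bool"
  where "self_adjoint D L \<longleftrightarrow>
    linear_operator_on D L \<and> closure D = UNIV \<and>
    adjoint_domain D L = D \<and> (\<forall>v\<in>D. adjoint_operator D L v = L v)"

text \<open>
  In \<open>resolvent_set\<close> it suffices to ask for a bounded real-linear inverse, because the inverse of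
  a complex-linear bijection is complex-linear.
\<close>

definition resolvent_set :: "'a::complex_inner set \<Rightarrow> ('a \<Rightarrow> 'a) \<Rightarrow> complex set"
  where "resolvent_set D L =
    {z. bij_betw (\<lambda>u. L u - z *\<^sub>C u) D UNIV \<and>
        bounded_linear (inv_into D (\<lambda>u. L u - z *\<^sub>C u))}"

definition spectrum :: "'a::complex_inner set \<Rightarrow> ('a \<Rightarrow> 'a) \<Rightarrow> complex set"
  where "spectrum D L = - resolvent_set D L"

definition eigenspace :: "'a::complex_inner set \<Rightarrow> ('a \<Rightarrow> 'a) \<Rightarrow> complex \<Rightarrow> 'a set"
  where "eigenspace D L z = {u\<in>D. L u = z *\<^sub>C u}"

definition infinite_multiplicity :: "'a::complex_inner set \<Rightarrow> ('a \<Rightarrow> 'a) \<Rightarrow> complex \<Rightarrow> bool"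
  where "infinite_multiplicity D L z \<longleftrightarrow>
    \<not> (\<exists>B. finite B \<and> eigenspace D L z \<subseteq> complex_vector.span B)"

definition essential_spectrum :: "'a::complex_inner set \<Rightarrow> ('a \<Rightarrow> 'a) \<Rightarrow> complex set"
  where "essential_spectrum D L =
    {z \<in> spectrum D L. z islimpt spectrum D L \<or> infinite_multiplicity D L z}"

text \<open>
  The infimum of a subset of the real line that is given as a set of complex numbers (the spectrum
  of a self-adjoint operator is real). It is taken in the extended reals, so that the infimum is
  \<open>\<infinity>\<close> for the empty set and \<open>- \<infinity>\<close> for sets unbounded below.
\<close>

definition real_Inf :: "complex set \<Rightarrow> ereal"
  where "real_Inf S = Inf (ereal ` {x. complex_of_real x \<in> S})"

definition proj_ball :: "'a::real_normed_vector \<Rightarrow> 'a"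
  where "proj_ball u = (if norm u \<le> 1 then u else u /\<^sub>R norm u)"

definition nonlinearity :: "(real \<Rightarrow> real) \<Rightarrow> 'a::real_normed_vector \<Rightarrow> 'a"
  where "nonlinearity \<phi> u = \<phi> (norm u) *\<^sub>R proj_ball u"

end

theory Submission
  imports Defs
begin

text \<open>
  The nonlinearity acts by a nonnegative scalar: \<open>N(u) = \<psi>(\<parallel>u\<parallel>) u\<close> with
  \<open>\<psi>(t) = \<phi>(t) / max 1 t\<close>. A solution of \<open>L u + N(u) = h\<close> is therefore a pair \<open>(s, u)\<close> with
  \<open>L u + s u = h\<close> and \<open>s = \<psi>(\<parallel>u\<parallel>)\<close>. While \<open>s > 0\<close> and \<open>- s\<close> is in the resolvent set, \<open>u\<close> is
  determined by \<open>s\<close> as \<open>u\<^sub>s = (L + s)\<^sup>-\<^sup>1 h\<close>, which depends continuously on \<open>s\<close>; so the problem is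
  to find a zero of the scalar function \<open>g(s) = \<psi>(\<parallel>u\<^sub>s\<parallel>) - s\<close>. The proof applies the
  intermediate value theorem (\<open>solution_between\<close>) on \<open>(0, b)\<close>, where \<open>- b\<close> is the largest negative
  point of the spectrum, or on \<open>(0, \<infinity>)\<close> if there is none. At each end either \<open>g\<close> has the right sign
  somewhere or a solution appears in the limit:

  \<^item> Near \<open>0\<close> (\<open>solution_at_zero_end\<close>) the gap of the spectrum gives \<open>s \<parallel>u\<^sub>s\<parallel> \<le> \<parallel>h\<parallel>\<close>. Where \<open>u\<^sub>s\<close> is
    large, the hypothesis \<open>liminf \<phi> > \<parallel>h\<parallel>\<close> thus yields \<open>\<psi>(\<parallel>u\<^sub>s\<parallel>) \<ge> s\<close>. If \<open>u\<^sub>s\<close> stays bounded and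
    \<open>\<psi>(\<parallel>u\<^sub>s\<parallel>) < s\<close> throughout, a subsequence converges to some \<open>v\<close> with \<open>L v = h\<close> and
    \<open>\<psi>(\<parallel>v\<parallel>) = 0\<close>.

  \<^item> Near \<open>b\<close> (\<open>solution_at_eigenvalue_end\<close>), where \<open>u\<^sub>s\<close> is large, \<open>\<psi>(\<parallel>u\<^sub>s\<parallel>)\<close> is small because
    \<open>\<phi>(t) / t\<close> tends to \<open>0\<close>. If \<open>u\<^sub>s\<close> stays bounded and \<open>\<psi>(\<parallel>u\<^sub>s\<parallel>) > s\<close> throughout, a subsequence
    converges to some \<open>v\<close> with \<open>L v + b v = h\<close> and \<open>\<psi>(\<parallel>v\<parallel>) \<ge> b\<close>. Since \<open>- b\<close> is not in the essential
    spectrum, it is isolated and hence an eigenvalue (\<open>isolated_imp_eigenvalue\<close>); adding a multiple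
    of an eigenvector to \<open>v\<close> increases the norm until \<open>\<psi>\<close> has dropped to \<open>b\<close>.

  \<^item> Without negative spectrum (\<open>solution_at_infinite_end\<close>), \<open>\<parallel>u\<^sub>s\<parallel> \<le> \<parallel>h\<parallel>\<close> for \<open>s \<ge> 1\<close>, so that
    \<open>\<psi>(\<parallel>u\<^sub>s\<parallel>)\<close> is bounded as \<open>s \<rightarrow> \<infinity>\<close>.

  The strong convergence of bounded solutions (\<open>bounded_solutions_converge\<close>) and the facts on
  isolated points take the place of the spectral theorem. Both rest on \<open>resolvent_estimate\<close>: the norm
  of the resolvent at a real point is at most the inverse of the distance to the spectrum. All of this
  concerns real scalars only and is carried out in real Hilbert spaces.
\<close>

section \<open>Dense subspaces of Hilbert spaces\<close>

lemma subspace_closure: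
  fixes S :: "'a::real_normed_vector set"
  assumes S: "subspace S"
  shows "subspace (closure S)"
proof (rule subspaceI)
  show "0 \<in> closure S" using subspace_0[OF S] closure_subset by blast
next
  fix x y assume "x \<in> closure S" "y \<in> closure S"
  then obtain f g where "\<And>n. f n \<in> S" "f \<longlonglongrightarrow> x" "\<And>n. g n \<in> S" "g \<longlonglongrightarrow> y"
    unfolding closure_sequential by blast
  then have "\<forall>n. f n + g n \<in> S" "(\<lambda>n. f n + g n) \<longlonglongrightarrow> x + y"
    using S by (auto intro: subspace_add tendsto_add)
  then show "x + y \<in> closure S" unfolding closure_sequential by (intro exI conjI)
next
  fix x and c :: real assume "x \<in> closure S"
  then obtain f where "\<And>n. f n \<in> S" "f \<longlonglongrightarrow> x"
    unfolding closure_sequential by blast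
  then have "\<forall>n. c *\<^sub>R f n \<in> S" "(\<lambda>n. c *\<^sub>R f n) \<longlonglongrightarrow> c *\<^sub>R x"
    using S by (auto intro: subspace_scale tendsto_scaleR)
  then show "c *\<^sub>R x \<in> closure S" unfolding closure_sequential by (intro exI conjI)
qed

text \<open>
  The projection theorem: the infimum of the distances from \<open>x\<close> to \<open>S\<close> is attained in the closure
  of \<open>S\<close>, because minimizing sequences are Cauchy by the parallelogram law, and the difference
  between \<open>x\<close> and the closest point is orthogonal to \<open>S\<close>.
\<close>

lemma orthogonal_trivial_imp_dense:
  fixes S :: "'a::{real_inner,complete_space} set"
  assumes S: "subspace S"
    and orth: "\<And>x. (\<And>y. y \<in> S \<Longrightarrow> y \<bullet> x = 0) \<Longrightarrow> x = 0"
  shows "closure S = UNIV"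
proof (intro set_eqI iffI UNIV_I)
  fix x :: 'a
  define d where "d = infdist x S"
  have ne: "S \<noteq> {}" using S subspace_0 by blast
  have d0: "0 \<le> d" by (simp add: d_def infdist_nonneg)
  have dle: "d \<le> norm (x - y)" if "y \<in> S" for y
    using infdist_le[OF that, of x] by (simp add: d_def dist_norm)
  have "\<exists>y\<in>S. norm (x - y) < d + inverse (real (Suc n))" for n
  proof -
    have "Inf (dist x ` S) < d + inverse (real (Suc n))"
      using ne by (simp add: d_def infdist_def)
    then show ?thesis
      using cInf_lessD[of "dist x ` S"] ne by (auto simp: dist_norm)
  qed
  then obtain y where yS: "\<And>n. y n \<in> S"
    and y: "\<And>n. norm (x - y n) < d + inverse (real (Suc n))"
    by metis
  define e where "e n = inverse (real (Suc n))" for n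
  have e0: "e \<longlonglongrightarrow> 0" unfolding e_def by (rule LIMSEQ_inverse_real_of_nat)
  have lim_norm: "(\<lambda>n. norm (x - y n)) \<longlonglongrightarrow> d"
  proof (rule tendsto_sandwich)
    show "\<forall>\<^sub>F n in sequentially. d \<le> norm (x - y n)" using dle yS by simp
    show "\<forall>\<^sub>F n in sequentially. norm (x - y n) \<le> d + e n" using y by (simp add: e_def less_imp_le)
    show "(\<lambda>n. d) \<longlonglongrightarrow> d" by simp
    show "(\<lambda>n. d + e n) \<longlonglongrightarrow> d" using tendsto_add[OF tendsto_const[of d] e0] by simp
  qed
  have sq: "(\<lambda>n. (norm (x - y n))\<^sup>2) \<longlonglongrightarrow> d\<^sup>2" by (intro tendsto_intros lim_norm)
  have par: "(norm (y m - y n))\<^sup>2 \<le> 2 * ((norm (x - y m))\<^sup>2 - d\<^sup>2) + 2 * ((norm (x - y n))\<^sup>2 - d\<^sup>2)"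
    for m n
  proof -
    have "(1/2) *\<^sub>R (y m + y n) \<in> S" using S yS by (simp add: subspace_add subspace_scale)
    from dle[OF this] d0 have "d\<^sup>2 \<le> (norm (x - (1/2) *\<^sub>R (y m + y n)))\<^sup>2"
      by (intro power_mono)
    moreover have "(norm (y m - y n))\<^sup>2 = 2 * (norm (x - y m))\<^sup>2 + 2 * (norm (x - y n))\<^sup>2
        - 4 * (norm (x - (1/2) *\<^sub>R (y m + y n)))\<^sup>2"
      unfolding power2_norm_eq_inner
      by (simp add: inner_simps inner_commute algebra_simps)
    ultimately show ?thesis by simp
  qed
  have "Cauchy y"
  proof (rule metric_CauchyI)
    fix r :: real assume r: "0 < r"
    then have "0 < r\<^sup>2 / 4" by simp
    then have "\<forall>\<^sub>F n in sequentially. (norm (x - y n))\<^sup>2 < d\<^sup>2 + r\<^sup>2 / 4"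
      using order_tendstoD(2)[OF sq, of "d\<^sup>2 + r\<^sup>2 / 4"] by simp
    then obtain M where M: "\<And>n. n \<ge> M \<Longrightarrow> (norm (x - y n))\<^sup>2 < d\<^sup>2 + r\<^sup>2 / 4"
      unfolding eventually_sequentially by auto
    have "dist (y m) (y n) < r" if "m \<ge> M" "n \<ge> M" for m n
    proof -
      have "(norm (y m - y n))\<^sup>2 < r\<^sup>2"
        using par[of m n] M[OF that(1)] M[OF that(2)] by (simp add: field_simps)
      then show ?thesis using r by (simp add: dist_norm power_less_imp_less_base)
    qed
    then show "\<exists>M. \<forall>m\<ge>M. \<forall>n\<ge>M. dist (y m) (y n) < r" by blast
  qed
  then obtain z where z: "y \<longlonglongrightarrow> z" using Cauchy_convergent convergent_def by blast
  have zS: "z \<in> closure S" using z yS closure_sequential by blast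
  have "(\<lambda>n. norm (x - y n)) \<longlonglongrightarrow> norm (x - z)" by (intro tendsto_intros z)
  then have nz: "norm (x - z) = d" using lim_norm LIMSEQ_unique by blast
  have min: "\<forall>w\<in>closure S. dist x z \<le> dist x w"
  proof
    fix w assume "w \<in> closure S"
    then obtain f where f: "\<And>n. f n \<in> S" "f \<longlonglongrightarrow> w" using closure_sequential by metis
    have "d \<le> norm (x - w)"
      by (rule tendsto_lowerbound[of "\<lambda>n. norm (x - f n)" _ sequentially])
        (use f dle in \<open>auto intro!: tendsto_intros\<close>)
    then show "dist x z \<le> dist x w" using nz by (simp add: dist_norm)
  qed
  have cS: "subspace (closure S)"
    by (rule subspace_closure[OF S])
  have "v \<bullet> (x - z) = 0" if v: "v \<in> S" for v
  proof -
    have vS: "v \<in> closure S" using v closure_subset by blast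
    have "z + v \<in> closure S" "z - v \<in> closure S"
      using cS zS vS by (auto simp: subspace_add subspace_diff)
    then have "(x - z) \<bullet> ((z + v) - z) \<le> 0" "(x - z) \<bullet> ((z - v) - z) \<le> 0"
      using any_closest_point_dot[OF subspace_imp_convex[OF cS] closed_closure zS _ min] by blast+
    then show ?thesis by (simp add: inner_commute)
  qed
  then have "x - z = 0" by (rule orth)
  then show "x \<in> closure S" using zS by simp
qed

lemma dense_orthogonal_eq_0:
  fixes x :: "'a::real_inner"
  assumes "closure D = UNIV" "\<And>u. u \<in> D \<Longrightarrow> u \<bullet> x = 0"
  shows "x = 0"
proof -
  have "x \<in> closure D" using assms(1) by simp
  then obtain f where f: "\<And>n. f n \<in> D" "f \<longlonglongrightarrow> x" using closure_sequential by metis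
  have "(\<lambda>n. f n \<bullet> x) \<longlonglongrightarrow> x \<bullet> x" by (intro tendsto_intros f)
  moreover have "(\<lambda>n. f n \<bullet> x) = (\<lambda>n. 0)" using f(1) assms(2) by auto
  ultimately have "x \<bullet> x = 0" by (simp add: LIMSEQ_const_iff)
  then show ?thesis by simp
qed

section \<open>Self-adjoint operators on real Hilbert spaces\<close>

text \<open>
  For a self-adjoint operator \<open>A\<close> and real \<open>s\<close>, boundedness below of \<open>A + s\<close> says that \<open>- s\<close> is in the
  resolvent set; it is much easier to perturb than bijectivity.
\<close>

definition bounded_below_on :: "'a::real_normed_vector set \<Rightarrow> ('a \<Rightarrow> 'a) \<Rightarrow> bool"
  where "bounded_below_on D T \<longleftrightarrow> (\<exists>c>0. \<forall>u\<in>D. c * norm u \<le> norm (T u))"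

lemma bounded_below_onE:
  assumes "bounded_below_on D T"
  obtains c where "c > 0" "\<And>u. u \<in> D \<Longrightarrow> c * norm u \<le> norm (T u)"
  using assms unfolding bounded_below_on_def by blast

text \<open>
  Maximality says that the adjoint does not extend the operator. It also forces the domain to be
  dense: if \<open>w\<close> is orthogonal to \<open>D\<close>, then \<open>v = 0\<close> gives \<open>w = A 0 = 0\<close>.
\<close>

locale real_self_adjoint =
  fixes D :: "'a::{real_inner,complete_space} set" and A :: "'a \<Rightarrow> 'a"
  assumes subspace_domain: "subspace D"
    and add: "\<lbrakk>u \<in> D; v \<in> D\<rbrakk> \<Longrightarrow> A (u + v) = A u + A v"
    and scale: "u \<in> D \<Longrightarrow> A (r *\<^sub>R u) = r *\<^sub>R A u"
    and symmetric: "\<lbrakk>u \<in> D; v \<in> D\<rbrakk> \<Longrightarrow> A u \<bullet> v = u \<bullet> A v"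
    and maximal: "(\<And>u. u \<in> D \<Longrightarrow> A u \<bullet> v = u \<bullet> w) \<Longrightarrow> v \<in> D \<and> A v = w"
begin

lemma domain_add: "\<lbrakk>u \<in> D; v \<in> D\<rbrakk> \<Longrightarrow> u + v \<in> D"
  and domain_scale: "u \<in> D \<Longrightarrow> r *\<^sub>R u \<in> D"
  and domain_diff: "\<lbrakk>u \<in> D; v \<in> D\<rbrakk> \<Longrightarrow> u - v \<in> D"
  using subspace_domain by (auto simp: subspace_add subspace_scale subspace_diff)

lemma diff: "\<lbrakk>u \<in> D; v \<in> D\<rbrakk> \<Longrightarrow> A (u - v) = A u - A v"
  using add[of u "(-1) *\<^sub>R v"] scale[of v "-1"] domain_scale[of v "-1"] by simp

lemma shift: "real_self_adjoint D (\<lambda>u. A u + c *\<^sub>R u)"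
proof
  fix v w assume *: "\<And>u. u \<in> D \<Longrightarrow> (A u + c *\<^sub>R u) \<bullet> v = u \<bullet> w"
  have "v \<in> D \<and> A v = w - c *\<^sub>R v"
    by (rule maximal) (use * in \<open>force simp: inner_simps\<close>)
  then show "v \<in> D \<and> A v + c *\<^sub>R v = w" by simp
qed (use subspace_domain in \<open>auto simp: add scale symmetric inner_simps algebra_simps\<close>)

lemma neg: "real_self_adjoint D (\<lambda>u. - A u)"
proof
  fix v w assume *: "\<And>u. u \<in> D \<Longrightarrow> (- A u) \<bullet> v = u \<bullet> w"
  have "v \<in> D \<and> A v = - w"
    by (rule maximal) (use * in \<open>force simp: inner_simps\<close>)
  then show "v \<in> D \<and> - A v = w" by simp
qed (use subspace_domain in \<open>auto simp: add scale symmetric inner_simps algebra_simps\<close>)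

lemma closed_graph:
  assumes "\<And>n. u n \<in> D" "u \<longlonglongrightarrow> v" "(\<lambda>n. A (u n)) \<longlonglongrightarrow> w"
  shows "v \<in> D" "A v = w"
proof -
  have "v \<in> D \<and> A v = w"
  proof (rule maximal)
    fix x assume x: "x \<in> D"
    have "(\<lambda>n. A x \<bullet> u n) \<longlonglongrightarrow> A x \<bullet> v" "(\<lambda>n. x \<bullet> A (u n)) \<longlonglongrightarrow> x \<bullet> w"
      by (intro tendsto_intros assms)+
    moreover have "(\<lambda>n. A x \<bullet> u n) = (\<lambda>n. x \<bullet> A (u n))"
      using symmetric x assms(1) by blast
    ultimately show "A x \<bullet> v = x \<bullet> w" using LIMSEQ_unique by metis
  qed
  then show "v \<in> D" "A v = w" by auto
qed

text \<open>A vector orthogonal to the range belongs, by maximality, to the kernel.\<close>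

lemma injective_imp_dense_range:
  assumes "\<And>u. \<lbrakk>u \<in> D; A u = 0\<rbrakk> \<Longrightarrow> u = 0"
  shows "closure (A ` D) = UNIV"
proof (rule orthogonal_trivial_imp_dense)
  have "A 0 = 0" using scale[of 0 0] subspace_0[OF subspace_domain] by simp
  then show "subspace (A ` D)"
  proof (intro subspaceI)
    show "0 \<in> A ` D" if "A 0 = 0" using subspace_0[OF subspace_domain] that by force
    show "x + y \<in> A ` D" if "x \<in> A ` D" "y \<in> A ` D" for x y
      using that by (auto simp: add[symmetric] intro!: imageI domain_add)
    show "c *\<^sub>R x \<in> A ` D" if "x \<in> A ` D" for c x
      using that by (auto simp: scale[symmetric] intro!: imageI domain_scale)
  qed
next
  fix x assume "\<And>y. y \<in> A ` D \<Longrightarrow> y \<bullet> x = 0"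
  then have "x \<in> D \<and> A x = 0" by (intro maximal) auto
  then show "x = 0" using assms by blast
qed

text \<open>The range is dense, and boundedness below makes it closed, as the graph is closed.\<close>

lemma bounded_below_surj:
  assumes "bounded_below_on D A"
  shows "\<exists>u\<in>D. A u = h"
proof -
  obtain c where c: "c > 0" "\<And>u. u \<in> D \<Longrightarrow> c * norm u \<le> norm (A u)"
    using bounded_below_onE[OF assms] by blast
  have "u = 0" if "u \<in> D" "A u = 0" for u
    using c(2)[OF that(1)] c(1) that(2) by (simp add: mult_le_0_iff)
  then have "h \<in> closure (A ` D)" using injective_imp_dense_range by simp
  then obtain f where f: "\<And>n. f n \<in> A ` D" "f \<longlonglongrightarrow> h" using closure_sequential by metis
  have "\<exists>u. u \<in> D \<and> A u = f n" for n
    using f(1)[of n] by (elim imageE) auto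
  then obtain u where u: "\<And>n. u n \<in> D" "\<And>n. A (u n) = f n" by metis
  have "Cauchy u"
  proof (rule metric_CauchyI)
    fix r :: real assume r: "0 < r"
    have "0 < c * r" using c(1) r by simp
    then obtain M where M: "\<forall>m\<ge>M. \<forall>n\<ge>M. dist (f m) (f n) < c * r"
      using metric_CauchyD[OF LIMSEQ_imp_Cauchy[OF f(2)]] by metis
    have "dist (u m) (u n) < r" if "m \<ge> M" "n \<ge> M" for m n
    proof -
      have "c * norm (u m - u n) \<le> norm (f m - f n)"
        using c(2)[OF domain_diff[OF u(1)[of m] u(1)[of n]]] by (simp add: diff u)
      also have "\<dots> < c * r" using M that by (simp add: dist_norm)
      finally show ?thesis using c(1) by (simp add: dist_norm)
    qed
    then show "\<exists>M. \<forall>m\<ge>M. \<forall>n\<ge>M. dist (u m) (u n) < r" by blast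
  qed
  then obtain v where "u \<longlonglongrightarrow> v" using Cauchy_convergent convergent_def by blast
  then show ?thesis using closed_graph[of u v h] u f(2) by auto
qed

lemma bounded_below_open:
  assumes "bounded_below_on D A"
  shows "\<exists>\<eta>>0. \<forall>r. \<bar>r\<bar> < \<eta> \<longrightarrow> bounded_below_on D (\<lambda>u. A u + r *\<^sub>R u)"
proof -
  obtain c where c: "c > 0" "\<And>u. u \<in> D \<Longrightarrow> c * norm u \<le> norm (A u)"
    using bounded_below_onE[OF assms] by blast
  have "bounded_below_on D (\<lambda>u. A u + r *\<^sub>R u)" if r: "\<bar>r\<bar> < c" for r
    unfolding bounded_below_on_def
  proof (intro exI[of _ "c - \<bar>r\<bar>"] conjI ballI)
    fix u assume u: "u \<in> D"
    have "norm (A u) \<le> norm (A u + r *\<^sub>R u) + \<bar>r\<bar> * norm u"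
      using norm_triangle_ineq4[of "A u + r *\<^sub>R u" "r *\<^sub>R u"] by simp
    then show "(c - \<bar>r\<bar>) * norm u \<le> norm (A u + r *\<^sub>R u)"
      using c(2)[OF u] by (simp add: algebra_simps)
  qed (use r in simp)
  then show ?thesis using c(1) by blast
qed

text \<open>
  Let \<open>\<kappa>\<close> be the best constant in
  \<open>\<parallel>A u\<parallel> \<ge> \<kappa> \<parallel>u\<parallel>\<close>, so that \<open>1 / \<kappa>\<close> is the norm of the inverse. As for every bounded self-adjoint
  operator, vectors almost attaining this norm are approximate eigenvectors of the square of the
  inverse, here for \<open>1 / \<kappa>\<^sup>2\<close>. So \<open>A\<^sup>2 - \<kappa>\<^sup>2 = (A - \<kappa>) (A + \<kappa>)\<close> is not bounded below, and therefore
  \<open>\<kappa>\<close> or \<open>- \<kappa>\<close> lies in the spectrum, which is impossible for \<open>\<kappa> < R\<close>.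
\<close>

lemma resolvent_estimate:
  assumes R: "\<And>r. \<bar>r\<bar> < R \<Longrightarrow> bounded_below_on D (\<lambda>u. A u + r *\<^sub>R u)"
    and u: "u \<in> D"
  shows "R * norm u \<le> norm (A u)"
proof (rule ccontr)
  assume neg: "\<not> R * norm u \<le> norm (A u)"
  have u0: "norm u > 0" using neg by (cases "u = 0") auto
  have Rpos: "R > 0"
  proof (rule ccontr)
    assume "\<not> R > 0"
    then have "R * norm u \<le> 0" by (simp add: mult_le_0_iff)
    then show False using neg norm_ge_zero[of "A u"] by linarith
  qed
  define Q where "Q = (\<lambda>y. norm (A y) / norm y) ` (D - {0})"
  define \<kappa> where "\<kappa> = Inf Q"
  obtain c where c: "c > 0" "\<And>u. u \<in> D \<Longrightarrow> c * norm u \<le> norm (A u)"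
    using R[of 0] Rpos unfolding bounded_below_on_def by auto
  have uQ: "norm (A u) / norm u \<in> Q" using u u0 by (auto simp: Q_def)
  have cQ: "c \<le> q" if q: "q \<in> Q" for q
  proof -
    obtain y where y: "y \<in> D" "y \<noteq> 0" "q = norm (A y) / norm y"
      using q by (auto simp: Q_def)
    then show ?thesis using c(2)[OF y(1)] by (simp add: pos_le_divide_eq)
  qed
  have bdd: "bdd_below Q" using cQ by (rule bdd_belowI)
  have \<kappa>pos: "\<kappa> > 0" using cInf_greatest[of Q c] uQ cQ c(1) by (force simp: \<kappa>_def)
  have "\<kappa> \<le> norm (A u) / norm u" using cInf_lower[OF uQ bdd] by (simp add: \<kappa>_def)
  also have "\<dots> < R" using neg u0 by (simp add: field_simps)
  finally have \<kappa>R: "\<kappa> < R" .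
  have \<kappa>le: "\<kappa> * norm y \<le> norm (A y)" if "y \<in> D" for y
  proof (cases "y = 0")
    case False
    then have "\<kappa> \<le> norm (A y) / norm y"
      using cInf_lower[OF _ bdd] that by (auto simp: \<kappa>_def Q_def)
    then show ?thesis using False by (simp add: field_simps)
  qed simp
  obtain a where a: "a > 0" "\<And>u. u \<in> D \<Longrightarrow> a * norm u \<le> norm (A u + \<kappa> *\<^sub>R u)"
    by (rule bounded_below_onE[OF R[of \<kappa>]]) (use \<kappa>pos \<kappa>R in auto)
  obtain b where b: "b > 0" "\<And>u. u \<in> D \<Longrightarrow> b * norm u \<le> norm (A u + (-\<kappa>) *\<^sub>R u)"
    by (rule bounded_below_onE[OF R[of "-\<kappa>"]]) (use \<kappa>pos \<kappa>R in auto)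
  \<comment> \<open>The factorization gives \<open>\<parallel>A z\<parallel> \<le> C \<parallel>(A\<^sup>2 - \<kappa>\<^sup>2) z\<parallel>\<close>; below, \<open>y = A z\<close> and \<open>q = (A\<^sup>2 - \<kappa>\<^sup>2) z\<close>.\<close>
  define C where "C = 1 / b + \<kappa> / (a * b)"
  have Cpos: "C > 0" using a b \<kappa>pos by (simp add: C_def add_pos_pos)
  \<comment> \<open>For \<open>y\<close> attaining the infimum up to \<open>\<eta>\<close>, \<open>\<parallel>q\<parallel>\<^sup>2 \<le> \<eta> \<parallel>y\<parallel>\<^sup>2\<close>; the contradiction needs \<open>C\<^sup>2 \<eta> < 1\<close>.\<close>
  define \<eta> where "\<eta> = 1 / (2 * C\<^sup>2)"
  have \<eta>pos: "\<eta> > 0" using Cpos by (simp add: \<eta>_def)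
  have "sqrt (\<kappa>\<^sup>2 + \<eta>) > \<kappa>" using \<kappa>pos \<eta>pos by (simp add: real_less_rsqrt)
  then obtain y where y: "y \<in> D" "y \<noteq> 0" "norm (A y) / norm y < sqrt (\<kappa>\<^sup>2 + \<eta>)"
    using cInf_lessD[of Q "sqrt (\<kappa>\<^sup>2 + \<eta>)"] uQ by (auto simp: \<kappa>_def Q_def)
  define x where "x = A y"
  have "norm x < sqrt (\<kappa>\<^sup>2 + \<eta>) * norm y" using y by (simp add: x_def field_simps)
  then have "(norm x)\<^sup>2 \<le> (sqrt (\<kappa>\<^sup>2 + \<eta>) * norm y)\<^sup>2" by (intro power_mono) auto
  then have x: "(norm x)\<^sup>2 \<le> (\<kappa>\<^sup>2 + \<eta>) * (norm y)\<^sup>2" using \<eta>pos by (simp add: power_mult_distrib)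
  have "bounded_below_on D A" using c unfolding bounded_below_on_def by blast
  then obtain z where z: "z \<in> D" "A z = y" using bounded_below_surj by blast
  define q where "q = x - \<kappa>\<^sup>2 *\<^sub>R z"
  have zx: "z \<bullet> x = (norm y)\<^sup>2"
    using symmetric[OF z(1) y(1)] z(2) by (simp add: x_def power2_norm_eq_inner)
  have kz: "\<kappa> * norm z \<le> norm y" using \<kappa>le[OF z(1)] z(2) by simp
  have "(norm q)\<^sup>2 = (norm x)\<^sup>2 - 2 * \<kappa>\<^sup>2 * (z \<bullet> x) + \<kappa>\<^sup>2 * (\<kappa> * norm z)\<^sup>2"
    unfolding q_def power2_norm_eq_inner power_mult_distrib
    by (simp add: inner_simps inner_commute algebra_simps power2_eq_square)
  also have "\<dots> \<le> (norm x)\<^sup>2 - 2 * \<kappa>\<^sup>2 * (norm y)\<^sup>2 + \<kappa>\<^sup>2 * (norm y)\<^sup>2"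
    using kz \<kappa>pos by (simp add: zx mult_left_mono power_mono)
  also have "\<dots> \<le> \<eta> * (norm y)\<^sup>2" using x by (simp add: algebra_simps)
  finally have q: "(norm q)\<^sup>2 \<le> \<eta> * (norm y)\<^sup>2" .
  define p where "p = A z + \<kappa> *\<^sub>R z"
  have pD: "p \<in> D" using z y domain_add domain_scale by (simp add: p_def)
  have "A p + (-\<kappa>) *\<^sub>R p = q"
    using z y domain_scale
    by (simp add: p_def q_def x_def add scale algebra_simps power2_eq_square)
  then have bp: "b * norm p \<le> norm q" using b(2)[OF pD] by simp
  have az: "a * norm z \<le> norm p" using a(2)[OF z(1)] by (simp add: p_def)
  have p': "norm p \<le> norm q / b" using bp b by (simp add: field_simps)
  have z': "norm z \<le> norm q / (a * b)"
  proof -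
    have "norm z \<le> norm p / a" using az a(1) by (simp add: field_simps)
    also have "\<dots> \<le> norm q / b / a" using p' a(1) by (intro divide_right_mono) auto
    finally show ?thesis by (simp add: mult.commute)
  qed
  have "norm y \<le> norm p + \<kappa> * norm z"
    using norm_triangle_ineq4[of p "\<kappa> *\<^sub>R z"] z(2) \<kappa>pos by (simp add: p_def)
  also have "\<dots> \<le> norm q / b + \<kappa> * (norm q / (a * b))"
    using p' z' \<kappa>pos by (intro add_mono mult_left_mono) auto
  also have "\<dots> = C * norm q" by (simp add: C_def algebra_simps)
  finally have "(norm y)\<^sup>2 \<le> (C * norm q)\<^sup>2" by (intro power_mono) auto
  also have "\<dots> \<le> C\<^sup>2 * (\<eta> * (norm y)\<^sup>2)" using q by (simp add: power_mult_distrib mult_left_mono)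
  also have "\<dots> = (norm y)\<^sup>2 / 2" using Cpos by (simp add: \<eta>_def)
  finally show False using y(2) by simp
qed

text \<open>
  In terms of the spectrum, \<open>\<lambda>\<^sup>2 + d \<lambda> \<ge> 0\<close> outside the gap \<open>(- d, 0)\<close>. The proof squares the
  resolvent estimate at the midpoint of the gap.
\<close>

lemma gap_form_nonneg:
  assumes gap: "\<And>r. \<lbrakk>0 < r; r < d\<rbrakk> \<Longrightarrow> bounded_below_on D (\<lambda>u. A u + r *\<^sub>R u)"
    and w: "w \<in> D" and d: "d \<ge> 0"
  shows "0 \<le> (norm (A w))\<^sup>2 + d * (A w \<bullet> w)"
proof -
  interpret B: real_self_adjoint D "\<lambda>u. A u + (d/2) *\<^sub>R u" by (rule shift)
  have "(d/2) * norm w \<le> norm (A w + (d/2) *\<^sub>R w)"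
  proof (rule B.resolvent_estimate[OF _ w])
    fix r assume "\<bar>r\<bar> < d / 2"
    then have "bounded_below_on D (\<lambda>u. A u + (d/2 + r) *\<^sub>R u)" by (intro gap) auto
    then show "bounded_below_on D (\<lambda>u. A u + (d/2) *\<^sub>R u + r *\<^sub>R u)"
      by (simp add: scaleR_add_left add.assoc)
  qed
  then have "((d/2) * norm w)\<^sup>2 \<le> (norm (A w + (d/2) *\<^sub>R w))\<^sup>2"
    using d by (intro power_mono) auto
  also have "\<dots> = (norm (A w))\<^sup>2 + d * (A w \<bullet> w) + ((d/2) * norm w)\<^sup>2"
    unfolding power_mult_distrib power2_norm_eq_inner
    by (simp add: inner_simps inner_commute algebra_simps power2_eq_square)
  finally show ?thesis by simp
qed

text \<open>
  The gaps on both sides of \<open>0\<close> give \<open>\<epsilon> \<bar>\<langle>A u, u\<rangle>\<bar> \<le> \<parallel>A u\<parallel>\<^sup>2\<close>. If the kernel were trivial, this would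
  bound the quadratic form of the densely defined inverse of \<open>A\<close>, as \<open>\<langle>y, A\<^sup>-\<^sup>1 y\<rangle> = \<langle>A u, u\<rangle>\<close> for
  \<open>y = A u\<close>. By polarization the inverse would be bounded by \<open>1 / \<epsilon>\<close>.
\<close>

lemma isolated_imp_eigenvalue:
  assumes \<epsilon>: "\<epsilon> > 0"
    and punct: "\<And>r. \<lbrakk>r \<noteq> 0; \<bar>r\<bar> < \<epsilon>\<rbrakk> \<Longrightarrow> bounded_below_on D (\<lambda>u. A u + r *\<^sub>R u)"
    and sing: "\<not> bounded_below_on D A"
  shows "\<exists>e\<in>D. e \<noteq> 0 \<and> A e = 0"
proof (rule ccontr)
  assume "\<not> ?thesis"
  then have dense: "closure (A ` D) = UNIV" by (intro injective_imp_dense_range) blast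
  interpret N: real_self_adjoint D "\<lambda>u. - A u" by (rule neg)
  have form: "\<epsilon> * \<bar>A u \<bullet> u\<bar> \<le> (norm (A u))\<^sup>2" if u: "u \<in> D" for u
  proof -
    have "0 \<le> (norm (A u))\<^sup>2 + \<epsilon> * (A u \<bullet> u)"
      by (rule gap_form_nonneg[OF punct u]) (use \<epsilon> in auto)
    moreover have "bounded_below_on D (\<lambda>u. - A u + r *\<^sub>R u)" if "0 < r" "r < \<epsilon>" for r
    proof -
      have "norm (- A u + r *\<^sub>R u) = norm (A u + (-r) *\<^sub>R u)" for u
        using norm_minus_commute[of "r *\<^sub>R u" "A u"] by simp
      then show ?thesis using punct[of "-r"] that by (simp add: bounded_below_on_def)
    qed
    then have "0 \<le> (norm (- A u))\<^sup>2 + \<epsilon> * ((- A u) \<bullet> u)"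
      by (rule N.gap_form_nonneg[OF _ u]) (use \<epsilon> in auto)
    ultimately show ?thesis by (cases "A u \<bullet> u \<ge> 0") (auto simp: abs_if)
  qed
  have polar: "2 * \<epsilon> * (u \<bullet> A x) \<le> (norm (A u))\<^sup>2 + (norm (A x))\<^sup>2"
    if u: "u \<in> D" and x: "x \<in> D" for u x
  proof -
    have s: "A u \<bullet> x = u \<bullet> A x" using symmetric u x by blast
    have "4 * (u \<bullet> A x) = A (u + x) \<bullet> (u + x) - A (u - x) \<bullet> (u - x)"
      using s by (simp add: add diff u x inner_simps inner_commute)
    also have "\<epsilon> * \<dots> \<le> (norm (A (u + x)))\<^sup>2 + (norm (A (u - x)))\<^sup>2"
    proof -
      have "\<epsilon> * (a - a') \<le> \<epsilon> * \<bar>a\<bar> + \<epsilon> * \<bar>a'\<bar>" for a a'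
        using \<epsilon> by (simp add: distrib_left[symmetric])
      then show ?thesis
        using form[OF domain_add[OF u x]] form[OF domain_diff[OF u x]] by (rule order_trans[OF _ add_mono])
    qed
    also have "\<dots> = 2 * ((norm (A u))\<^sup>2 + (norm (A x))\<^sup>2)"
      unfolding power2_norm_eq_inner
      by (simp add: add diff u x inner_simps inner_commute)
    finally show ?thesis by (simp add: algebra_simps)
  qed
  have "\<epsilon> * norm u \<le> norm (A u)" if u: "u \<in> D" for u
  proof -
    \<comment> \<open>The polarized inequality is used with \<open>A x\<close> close to \<open>\<epsilon> u\<close>, the optimal multiple of \<open>u\<close>.\<close>
    have "\<epsilon> *\<^sub>R u \<in> closure (A ` D)" using dense by simp
    then obtain f where f: "\<And>n. f n \<in> A ` D" "f \<longlonglongrightarrow> \<epsilon> *\<^sub>R u" using closure_sequential by metis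
    have "2 * \<epsilon> * (u \<bullet> f n) \<le> (norm (A u))\<^sup>2 + (norm (f n))\<^sup>2" for n
      using f(1)[of n] polar[OF u] by auto
    moreover have "(\<lambda>n. 2 * \<epsilon> * (u \<bullet> f n)) \<longlonglongrightarrow> 2 * \<epsilon> * (u \<bullet> (\<epsilon> *\<^sub>R u))"
      "(\<lambda>n. (norm (A u))\<^sup>2 + (norm (f n))\<^sup>2) \<longlonglongrightarrow> (norm (A u))\<^sup>2 + (norm (\<epsilon> *\<^sub>R u))\<^sup>2"
      by (intro tendsto_intros f)+
    ultimately have "2 * \<epsilon> * (u \<bullet> (\<epsilon> *\<^sub>R u)) \<le> (norm (A u))\<^sup>2 + (norm (\<epsilon> *\<^sub>R u))\<^sup>2"
      by (intro LIMSEQ_le) auto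
    with \<epsilon> have "(\<epsilon> * norm u)\<^sup>2 \<le> (norm (A u))\<^sup>2"
      by (simp add: dot_square_norm power2_eq_square mult_ac)
    then show ?thesis by (rule power2_le_imp_le) simp
  qed
  then show False using sing \<epsilon> unfolding bounded_below_on_def by blast
qed

section \<open>Limits of solutions at the edge of a spectral gap\<close>

text \<open>
  For a nonnegative operator \<open>A\<close> this is the classical convergence of Yosida approximations: testing
  the difference of two equations with \<open>w = u m - u n\<close> gives
  \<open>(s m + s n) \<parallel>w\<parallel>\<^sup>2 \<le> (s m - s n) (\<parallel>u n\<parallel>\<^sup>2 - \<parallel>u m\<parallel>\<^sup>2)\<close>, so that convergence of the norms entails
  convergence of the vectors. When \<open>A\<close> merely has a spectral gap to the left of \<open>0\<close>, the form inequality
  permits an additional error \<open>2 \<parallel>A w\<parallel>\<^sup>2 / d\<close>. Since \<open>A w = s n u n - s m u m\<close>, this is quadratic in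
  \<open>s m + s n\<close> and harmless after division by \<open>s m + s n\<close>.
\<close>

lemma bounded_solutions_converge:
  assumes d: "d > 0"
    and form: "\<And>w. w \<in> D \<Longrightarrow> 0 \<le> (norm (A w))\<^sup>2 + d * (A w \<bullet> w)"
    and s: "\<And>n. 0 < s n" "s \<longlonglongrightarrow> 0"
    and u: "\<And>n. u n \<in> D" "\<And>n. A (u n) + s n *\<^sub>R u n = h"
    and bound: "\<And>n::nat. norm (u n) \<le> M"
  shows "\<exists>v\<in>D. \<exists>r. strict_mono r \<and> (u \<circ> r) \<longlonglongrightarrow> v \<and> A v = h"
proof -
  define C where "C = 2 * M\<^sup>2 / d"
  have est: "(norm (u m - u n))\<^sup>2 \<le> \<bar>(norm (u m))\<^sup>2 - (norm (u n))\<^sup>2\<bar> + C * (s m + s n)" for m n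
  proof -
    define w where "w = u m - u n"
    define p where "p = s n *\<^sub>R u n - s m *\<^sub>R u m"
    define S where "S = s m + s n"
    define X where "X = (norm (u n))\<^sup>2 - (norm (u m))\<^sup>2"
    have S: "S > 0" using s by (simp add: S_def add_pos_pos)
    have "A w = p"
      using u(2)[of m] u(2)[of n] by (simp add: w_def p_def diff u(1) eq_diff_eq[symmetric])
    then have "0 \<le> (norm p)\<^sup>2 + d * (p \<bullet> w)"
      using form[of w] domain_diff[OF u(1) u(1)] by (simp add: w_def)
    then have 1: "- 2 * (p \<bullet> w) \<le> 2 * (norm p)\<^sup>2 / d" using d by (simp add: field_simps)
    have 2: "- 2 * (p \<bullet> w) = S * (norm w)\<^sup>2 - (s m - s n) * X"
      unfolding p_def w_def S_def X_def power2_norm_eq_inner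
      by (simp add: inner_simps inner_commute algebra_simps)
    have "norm p \<le> norm (s n *\<^sub>R u n) + norm (s m *\<^sub>R u m)"
      unfolding p_def by (rule norm_triangle_ineq4)
    also have "\<dots> \<le> s n * M + s m * M"
      using s(1)[of m] s(1)[of n] bound[of m] bound[of n] by (auto intro!: add_mono mult_left_mono)
    finally have "norm p \<le> S * M" by (simp add: S_def algebra_simps)
    then have "(norm p)\<^sup>2 \<le> (S * M)\<^sup>2" by (intro power_mono) auto
    then have "2 * (norm p)\<^sup>2 / d \<le> 2 * (S * M)\<^sup>2 / d"
      using d by (intro divide_right_mono) auto
    then have 3: "2 * (norm p)\<^sup>2 / d \<le> S * (C * S)"
      by (simp add: C_def power2_eq_square mult_ac)
    have "\<bar>s m - s n\<bar> \<le> S" using s(1)[of m] s(1)[of n] by (simp add: S_def)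
    then have "(s m - s n) * X \<le> S * \<bar>X\<bar>"
      using abs_ge_self[of "(s m - s n) * X"] mult_right_mono[of "\<bar>s m - s n\<bar>" S "\<bar>X\<bar>"]
      by (simp add: abs_mult)
    then have "S * (norm w)\<^sup>2 \<le> S * (\<bar>X\<bar> + C * S)" using 1 2 3 by (simp add: algebra_simps)
    then have "(norm w)\<^sup>2 \<le> \<bar>X\<bar> + C * S" using S by simp
    then show ?thesis by (simp add: w_def X_def S_def abs_minus_commute)
  qed
  have "\<forall>n. norm (u n) \<in> {0..M}" using bound by simp
  then obtain a r where r: "strict_mono r" and a: "((\<lambda>n. norm (u n)) \<circ> r) \<longlonglongrightarrow> a"
    using compact_Icc[of 0 M] unfolding compact_def by meson
  have a2: "(\<lambda>n. (norm (u (r n)))\<^sup>2) \<longlonglongrightarrow> a\<^sup>2"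
    using a by (intro tendsto_intros) (simp add: o_def)
  have sr: "(\<lambda>n. s (r n)) \<longlonglongrightarrow> 0"
    using LIMSEQ_subseq_LIMSEQ[OF s(2) r] by (simp add: o_def)
  have "(\<lambda>n. \<bar>(norm (u (r n)))\<^sup>2 - a\<^sup>2\<bar> + C * s (r n)) \<longlonglongrightarrow> \<bar>a\<^sup>2 - a\<^sup>2\<bar> + C * 0"
    by (intro tendsto_intros a2 sr)
  then have e0: "(\<lambda>n. \<bar>(norm (u (r n)))\<^sup>2 - a\<^sup>2\<bar> + C * s (r n)) \<longlonglongrightarrow> 0" by simp
  have "Cauchy (u \<circ> r)"
  proof (rule metric_CauchyI)
    fix \<rho> :: real assume \<rho>: "0 < \<rho>"
    then have "\<forall>\<^sub>F n in sequentially. \<bar>(norm (u (r n)))\<^sup>2 - a\<^sup>2\<bar> + C * s (r n) < \<rho>\<^sup>2 / 2"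
      by (intro order_tendstoD(2)[OF e0]) simp
    then obtain K where K: "\<And>n. n \<ge> K \<Longrightarrow> \<bar>(norm (u (r n)))\<^sup>2 - a\<^sup>2\<bar> + C * s (r n) < \<rho>\<^sup>2 / 2"
      unfolding eventually_sequentially by auto
    have "dist ((u \<circ> r) m) ((u \<circ> r) n) < \<rho>" if "m \<ge> K" "n \<ge> K" for m n
    proof -
      have "(norm (u (r m) - u (r n)))\<^sup>2 < \<rho>\<^sup>2"
        using est[of "r m" "r n"] K[OF that(1)] K[OF that(2)]
          abs_triangle_ineq4[of "(norm (u (r m)))\<^sup>2 - a\<^sup>2" "(norm (u (r n)))\<^sup>2 - a\<^sup>2"]
        unfolding distrib_left by simp
      then show ?thesis using \<rho> by (simp add: dist_norm power_less_imp_less_base)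
    qed
    then show "\<exists>K. \<forall>m\<ge>K. \<forall>n\<ge>K. dist ((u \<circ> r) m) ((u \<circ> r) n) < \<rho>" by blast
  qed
  then obtain v where v: "(u \<circ> r) \<longlonglongrightarrow> v" using Cauchy_convergent convergent_def by blast
  have "(\<lambda>n. h - s (r n) *\<^sub>R (u \<circ> r) n) \<longlonglongrightarrow> h - 0 *\<^sub>R v" by (intro tendsto_intros sr v)
  moreover have "h - s (r n) *\<^sub>R (u \<circ> r) n = A ((u \<circ> r) n)" for n
    using u(2)[of "r n"] by (simp add: algebra_simps)
  ultimately have "(\<lambda>n. A ((u \<circ> r) n)) \<longlonglongrightarrow> h" by simp
  then have "v \<in> D" "A v = h" using closed_graph[of "u \<circ> r" v h] u(1) v by auto
  then show ?thesis using r v by blast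
qed

section \<open>The scalar equation along the resolvent curve\<close>

text \<open>
  The resolvent estimate applies to \<open>A + s\<close> with radius \<open>s\<close> only if \<open>(- 2 s, 0)\<close> is contained in the
  gap \<open>(- d, 0)\<close>; for this reason the approximating sequence stays below \<open>d / 2\<close>.
\<close>

lemma solution_at_zero_end:
  assumes d: "d > 0"
    and gap: "\<And>s. \<lbrakk>0 < s; s < d\<rbrakk> \<Longrightarrow> bounded_below_on D (\<lambda>u. A u + s *\<^sub>R u)"
    and cont: "continuous_on {0..} \<psi>"
    and nonneg: "\<And>t. t \<ge> 0 \<Longrightarrow> \<psi> t \<ge> 0"
    and large: "\<forall>\<^sub>F t in at_top. norm h \<le> \<psi> t * t"
  shows "(\<exists>u\<in>D. A u + \<psi> (norm u) *\<^sub>R u = h) \<or>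
    (\<exists>s u. 0 < s \<and> s < d \<and> u \<in> D \<and> A u + s *\<^sub>R u = h \<and> s \<le> \<psi> (norm u))"
proof (rule disjCI)
  assume "\<not> (\<exists>s u. 0 < s \<and> s < d \<and> u \<in> D \<and> A u + s *\<^sub>R u = h \<and> s \<le> \<psi> (norm u))"
  then have small: "\<psi> (norm u) < s" if "0 < s" "s < d" "u \<in> D" "A u + s *\<^sub>R u = h" for s u
    using that by force
  define s where "s n = (d/2) * inverse (real (Suc n))" for n
  have s: "0 < s n" "s n \<le> d / 2" for n
    using d by (auto simp: s_def field_simps)
  have "s \<longlonglongrightarrow> (d/2) * 0" unfolding s_def by (intro tendsto_intros LIMSEQ_inverse_real_of_nat)
  then have s0: "s \<longlonglongrightarrow> 0" by simp
  have sd: "s n < d" for n using s(2)[of n] d by linarith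
  have "\<exists>u\<in>D. A u + s n *\<^sub>R u = h" for n
    by (rule real_self_adjoint.bounded_below_surj[OF shift gap[OF s(1) sd]])
  then obtain u where u: "\<And>n. u n \<in> D" "\<And>n. A (u n) + s n *\<^sub>R u n = h" by metis
  have su: "s n * norm (u n) \<le> norm h" for n
  proof -
    have "s n * norm (u n) \<le> norm (A (u n) + s n *\<^sub>R u n)"
    proof (rule real_self_adjoint.resolvent_estimate[OF shift _ u(1)])
      fix r assume "\<bar>r\<bar> < s n"
      then have "bounded_below_on D (\<lambda>u. A u + (s n + r) *\<^sub>R u)"
        using s(2)[of n] by (intro gap) auto
      then show "bounded_below_on D (\<lambda>u. A u + s n *\<^sub>R u + r *\<^sub>R u)"
        by (simp add: scaleR_add_left add.assoc)
    qed
    then show ?thesis by (simp add: u(2))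
  qed
  obtain T' where T': "\<And>t. t \<ge> T' \<Longrightarrow> norm h \<le> \<psi> t * t"
    using large unfolding eventually_at_top_linorder by blast
  define T where "T = max T' 1"
  have T: "T > 0" "\<And>t. t \<ge> T \<Longrightarrow> norm h \<le> \<psi> t * t"
    using T' by (auto simp: T_def)
  have bound: "norm (u n) \<le> T" for n
  proof (rule ccontr)
    assume "\<not> norm (u n) \<le> T"
    then have "norm h \<le> \<psi> (norm (u n)) * norm (u n)" "norm (u n) > 0" using T by auto
    then have "s n * norm (u n) \<le> \<psi> (norm (u n)) * norm (u n)" using su[of n] by linarith
    then have "s n \<le> \<psi> (norm (u n))" using \<open>norm (u n) > 0\<close> by simp
    then show False using small[OF s(1) sd u(1) u(2), of n] by simp
  qed
  obtain v r where v: "v \<in> D" "strict_mono r" "(u \<circ> r) \<longlonglongrightarrow> v" "A v = h"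
    using bounded_solutions_converge[OF d gap_form_nonneg[OF gap] s(1) s0 u bound] d by auto
  have "(\<lambda>n. \<psi> (norm ((u \<circ> r) n))) \<longlonglongrightarrow> \<psi> (norm v)"
    by (rule continuous_on_tendsto_compose[OF cont]) (auto intro!: tendsto_intros v(3)[unfolded o_def])
  moreover have "(\<lambda>n. \<psi> (norm ((u \<circ> r) n))) \<longlonglongrightarrow> 0"
  proof (rule tendsto_sandwich)
    show "\<forall>\<^sub>F n in sequentially. 0 \<le> \<psi> (norm ((u \<circ> r) n))" using nonneg by simp
    show "\<forall>\<^sub>F n in sequentially. \<psi> (norm ((u \<circ> r) n)) \<le> (s \<circ> r) n"
      using small[OF s(1) sd u(1) u(2)] by (simp add: less_imp_le)
    show "(s \<circ> r) \<longlonglongrightarrow> 0" using LIMSEQ_subseq_LIMSEQ[OF s0 v(2)] .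
  qed simp
  ultimately have "\<psi> (norm v) = 0" by (rule LIMSEQ_unique)
  then show "\<exists>u\<in>D. A u + \<psi> (norm u) *\<^sub>R u = h" using v by (intro bexI[of _ v]) simp_all
qed

text \<open>
  The limit \<open>v\<close> of bounded solutions, if there is one, only satisfies \<open>\<psi> (norm v) \<ge> b\<close>. Every vector on
  the half-line from \<open>v\<close> in the direction of \<open>e\<close> solves the equation for \<open>s = b\<close>, and on it \<open>\<psi>\<close> of
  the norm falls continuously below \<open>b\<close>.
\<close>

lemma solution_at_eigenvalue_end:
  assumes b: "b > 0"
    and gap: "\<And>s. \<lbrakk>0 < s; s < b\<rbrakk> \<Longrightarrow> bounded_below_on D (\<lambda>u. A u + s *\<^sub>R u)"
    and e: "e \<in> D" "e \<noteq> 0" "A e + b *\<^sub>R e = 0"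
    and cont: "continuous_on {0..} \<psi>"
    and lim: "(\<psi> \<longlongrightarrow> 0) at_top"
  shows "(\<exists>u\<in>D. A u + \<psi> (norm u) *\<^sub>R u = h) \<or>
    (\<exists>s u. 0 < s \<and> s < b \<and> u \<in> D \<and> A u + s *\<^sub>R u = h \<and> \<psi> (norm u) \<le> s)"
proof (rule disjCI)
  assume "\<not> (\<exists>s u. 0 < s \<and> s < b \<and> u \<in> D \<and> A u + s *\<^sub>R u = h \<and> \<psi> (norm u) \<le> s)"
  then have big: "s < \<psi> (norm u)" if "0 < s" "s < b" "u \<in> D" "A u + s *\<^sub>R u = h" for s u
    using that by force
  define t where "t n = (b/2) * inverse (real (Suc n))" for n
  have t: "0 < t n" "t n \<le> b / 2" for n
    using b by (auto simp: t_def field_simps)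
  have "t \<longlonglongrightarrow> (b/2) * 0" unfolding t_def by (intro tendsto_intros LIMSEQ_inverse_real_of_nat)
  then have t0: "t \<longlonglongrightarrow> 0" by simp
  have s: "0 < b - t n" "b - t n < b" for n using t[of n] b by linarith+
  have "\<exists>u\<in>D. A u + (b - t n) *\<^sub>R u = h" for n
    by (rule real_self_adjoint.bounded_below_surj[OF shift gap[OF s]])
  then obtain u where u: "\<And>n. u n \<in> D" "\<And>n. A (u n) + (b - t n) *\<^sub>R u n = h" by metis
  have "\<forall>\<^sub>F x in at_top. \<psi> x < b / 2" using order_tendstoD(2)[OF lim, of "b/2"] b by simp
  then obtain T where T: "\<And>x. x \<ge> T \<Longrightarrow> \<psi> x < b / 2"
    unfolding eventually_at_top_linorder by blast
  have bound: "norm (u n) \<le> T" for n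
    using big[OF s u(1) u(2), of n] T[of "norm (u n)"] t(2)[of n] by linarith
  \<comment> \<open>Seen from the eigenvalue, the gap lies on the other side, so the sign is reversed.\<close>
  define B where "B = (\<lambda>u. - (A u + b *\<^sub>R u))"
  interpret B: real_self_adjoint D B
    unfolding B_def by (rule real_self_adjoint.neg[OF shift])
  have Bgap: "bounded_below_on D (\<lambda>u. B u + r *\<^sub>R u)" if r: "0 < r" "r < b" for r
  proof -
    have "norm (B u + r *\<^sub>R u) = norm (A u + (b - r) *\<^sub>R u)" for u
      using norm_minus_cancel[of "A u + (b - r) *\<^sub>R u"] by (simp add: B_def algebra_simps)
    then show ?thesis using gap[of "b - r"] r by (simp add: bounded_below_on_def)
  qed
  have uB: "B (u n) + t n *\<^sub>R u n = - h" for n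
    using u(2)[of n] by (simp add: B_def algebra_simps)
  obtain v r where v: "v \<in> D" "strict_mono r" "(u \<circ> r) \<longlonglongrightarrow> v" "B v = - h"
    using B.bounded_solutions_converge[OF b B.gap_form_nonneg[OF Bgap] t(1) t0 u(1) uB bound] b
    by auto
  have "(\<lambda>n. \<psi> (norm ((u \<circ> r) n))) \<longlonglongrightarrow> \<psi> (norm v)"
    by (rule continuous_on_tendsto_compose[OF cont]) (auto intro!: tendsto_intros v(3)[unfolded o_def])
  moreover have "(\<lambda>n. b - (t \<circ> r) n) \<longlonglongrightarrow> b - 0"
    by (intro tendsto_intros LIMSEQ_subseq_LIMSEQ[OF t0 v(2)])
  moreover have "b - (t \<circ> r) n \<le> \<psi> (norm ((u \<circ> r) n))" for n
    using big[OF s u(1) u(2), of "r n"] by simp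
  ultimately have vb: "b \<le> \<psi> (norm v)" using LIMSEQ_le by fastforce
  define \<tau>0 where "\<tau>0 = (\<bar>T\<bar> + norm v) / norm e"
  have \<tau>0: "0 \<le> \<tau>0" by (simp add: \<tau>0_def)
  have "norm (v + \<tau>0 *\<^sub>R e) \<ge> T"
    using norm_triangle_ineq4[of "v + \<tau>0 *\<^sub>R e" v] e(2) by (simp add: \<tau>0_def)
  then have "\<psi> (norm (v + \<tau>0 *\<^sub>R e)) \<le> b" using T b by force
  moreover have "continuous_on {0..\<tau>0} (\<lambda>\<tau>. \<psi> (norm (v + \<tau> *\<^sub>R e)))"
    by (rule continuous_on_compose2[OF cont]) (auto intro!: continuous_intros)
  ultimately obtain \<tau> where \<tau>: "\<psi> (norm (v + \<tau> *\<^sub>R e)) = b"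
    using IVT2'[of "\<lambda>\<tau>. \<psi> (norm (v + \<tau> *\<^sub>R e))" \<tau>0 b 0] vb \<tau>0 by auto
  have "A v + b *\<^sub>R v = h" using v(4) unfolding B_def neg_equal_iff_equal .
  then have "A (v + \<tau> *\<^sub>R e) + b *\<^sub>R (v + \<tau> *\<^sub>R e) = h + \<tau> *\<^sub>R (A e + b *\<^sub>R e)"
    using v(1) e(1) domain_scale by (simp add: add scale algebra_simps)
  then have "A (v + \<tau> *\<^sub>R e) + \<psi> (norm (v + \<tau> *\<^sub>R e)) *\<^sub>R (v + \<tau> *\<^sub>R e) = h" using e(3) \<tau> by simp
  then show "\<exists>u\<in>D. A u + \<psi> (norm u) *\<^sub>R u = h"
    using domain_add[OF v(1) domain_scale[OF e(1)]] by blast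
qed

lemma solution_at_infinite_end:
  assumes reg: "\<And>s. 0 < s \<Longrightarrow> bounded_below_on D (\<lambda>u. A u + s *\<^sub>R u)"
    and cont: "continuous_on {0..} \<psi>"
  shows "\<exists>s u. 0 < s \<and> u \<in> D \<and> A u + s *\<^sub>R u = h \<and> \<psi> (norm u) \<le> s"
proof -
  have "compact (\<psi> ` {0..norm h})"
    by (rule compact_continuous_image) (auto intro: continuous_on_subset[OF cont])
  then obtain K where K: "\<And>x. x \<in> {0..norm h} \<Longrightarrow> \<psi> x \<le> K"
    using compact_imp_bounded bounded_imp_bdd_above by (metis bdd_above_def imageI)
  define s where "s = max K 1"
  have s: "s \<ge> 1" "s \<ge> K" by (auto simp: s_def)
  then obtain u where u: "u \<in> D" "A u + s *\<^sub>R u = h"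
    using real_self_adjoint.bounded_below_surj[OF shift reg[of s]] by force
  have "s * norm u \<le> norm (A u + s *\<^sub>R u)"
  proof (rule real_self_adjoint.resolvent_estimate[OF shift _ u(1)])
    fix r assume "\<bar>r\<bar> < s"
    then have "bounded_below_on D (\<lambda>u. A u + (s + r) *\<^sub>R u)" by (intro reg) auto
    then show "bounded_below_on D (\<lambda>u. A u + s *\<^sub>R u + r *\<^sub>R u)"
      by (simp add: scaleR_add_left add.assoc)
  qed
  moreover have "1 * norm u \<le> s * norm u" using s by (intro mult_right_mono) auto
  ultimately have "norm u \<le> norm h" using u(2) by simp
  then have "\<psi> (norm u) \<le> s" using K[of "norm u"] s by simp
  then show ?thesis using u s by (intro exI[of _ s] exI[of _ u]) auto
qed

text \<open>
  The intermediate value theorem for \<open>\<psi> (norm (u s)) - s\<close>, where \<open>u s\<close> solves \<open>A u + s u = h\<close>. A segment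
  instead of an interval makes the order of the two end points irrelevant.
\<close>

lemma solution_between:
  assumes p: "u\<^sub>1 \<in> D" "A u\<^sub>1 + s\<^sub>1 *\<^sub>R u\<^sub>1 = h" "s\<^sub>1 \<le> \<psi> (norm u\<^sub>1)"
    and q: "u\<^sub>2 \<in> D" "A u\<^sub>2 + s\<^sub>2 *\<^sub>R u\<^sub>2 = h" "\<psi> (norm u\<^sub>2) \<le> s\<^sub>2"
    and reg: "\<And>s. s \<in> closed_segment s\<^sub>1 s\<^sub>2 \<Longrightarrow> bounded_below_on D (\<lambda>u. A u + s *\<^sub>R u)"
    and cont: "continuous_on {0..} \<psi>"
  shows "\<exists>u\<in>D. A u + \<psi> (norm u) *\<^sub>R u = h"
proof -
  let ?I = "closed_segment s\<^sub>1 s\<^sub>2"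
  have "\<exists>u\<in>D. A u + s *\<^sub>R u = h" if "s \<in> ?I" for s
    by (rule real_self_adjoint.bounded_below_surj[OF shift reg[OF that]])
  then obtain u where u: "\<And>s. s \<in> ?I \<Longrightarrow> u s \<in> D" "\<And>s. s \<in> ?I \<Longrightarrow> A (u s) + s *\<^sub>R u s = h"
    by metis
  \<comment> \<open>Continuity of the resolvent; the case \<open>t = s\<close> is uniqueness.\<close>
  have stab: "\<exists>c>0. \<forall>t x. x \<in> D \<longrightarrow> A x + t *\<^sub>R x = h \<longrightarrow> c * norm (x - u s) \<le> \<bar>t - s\<bar> * norm x"
    if s: "s \<in> ?I" for s
  proof -
    obtain c where c: "c > 0" "\<And>u. u \<in> D \<Longrightarrow> c * norm u \<le> norm (A u + s *\<^sub>R u)"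
      using bounded_below_onE[OF reg[OF s]] by blast
    have "c * norm (x - u s) \<le> \<bar>t - s\<bar> * norm x" if x: "x \<in> D" "A x + t *\<^sub>R x = h" for t x
    proof -
      have "A (x - u s) + s *\<^sub>R (x - u s) = (A x + s *\<^sub>R x) - (A (u s) + s *\<^sub>R u s)"
        using x u(1)[OF s] by (simp add: diff algebra_simps)
      also have "\<dots> = (s - t) *\<^sub>R x" using x(2) u(2)[OF s] by (simp add: algebra_simps)
      finally have "A (x - u s) + s *\<^sub>R (x - u s) = (s - t) *\<^sub>R x" .
      then show ?thesis
        using c(2)[OF domain_diff[OF x(1) u(1)[OF s]]] by (simp add: abs_minus_commute)
    qed
    then show ?thesis using c(1) by blast
  qed
  have uniq: "x = u s" if s: "s \<in> ?I" and x: "x \<in> D" "A x + s *\<^sub>R x = h" for s x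
  proof -
    obtain c where "c > 0" "c * norm (x - u s) \<le> \<bar>s - s\<bar> * norm x"
      using stab[OF s] x by blast
    then show ?thesis by (simp add: mult_le_0_iff)
  qed
  have "continuous_on ?I u"
    unfolding continuous_on_def
  proof
    fix s assume s: "s \<in> ?I"
    obtain c where c: "c > 0"
      "\<forall>t x. x \<in> D \<longrightarrow> A x + t *\<^sub>R x = h \<longrightarrow> c * norm (x - u s) \<le> \<bar>t - s\<bar> * norm x"
      using stab[OF s] by blast
    have near: "norm (u t - u s) \<le> (2 / c) * \<bar>t - s\<bar> * norm (u s)"
      if t: "t \<in> ?I" "\<bar>t - s\<bar> < c / 2" for t
    proof -
      have "c * norm (u t - u s) \<le> \<bar>t - s\<bar> * norm (u t)" using c(2) u t(1) by blast
      also have "\<dots> \<le> \<bar>t - s\<bar> * (norm (u t - u s) + norm (u s))"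
        using norm_triangle_ineq[of "u t - u s" "u s"] by (intro mult_left_mono) auto
      also have "\<dots> \<le> (c / 2) * norm (u t - u s) + \<bar>t - s\<bar> * norm (u s)"
        using mult_right_mono[of "\<bar>t - s\<bar>" "c / 2" "norm (u t - u s)"] t(2)
        by (simp add: distrib_left)
      finally show ?thesis using c(1) by (simp add: field_simps)
    qed
    have "((\<lambda>t. (2 / c) * \<bar>t - s\<bar> * norm (u s)) \<longlongrightarrow> (2 / c) * \<bar>s - s\<bar> * norm (u s)) (at s within ?I)"
      by (intro tendsto_intros)
    then have lim: "((\<lambda>t. (2 / c) * \<bar>t - s\<bar> * norm (u s)) \<longlongrightarrow> 0) (at s within ?I)" by simp
    have "\<forall>\<^sub>F t in at s within ?I. t \<in> ?I \<and> \<bar>t - s\<bar> < c / 2"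
      unfolding eventually_at using c(1) by (intro exI[of _ "c/2"]) (auto simp: dist_real_def)
    then have "\<forall>\<^sub>F t in at s within ?I. norm (u t - u s) \<le> (2 / c) * \<bar>t - s\<bar> * norm (u s)"
      by (rule eventually_mono) (use near in blast)
    then have "((\<lambda>t. u t - u s) \<longlongrightarrow> 0) (at s within ?I)"
      by (rule Lim_null_comparison) (rule lim)
    then show "(u \<longlongrightarrow> u s) (at s within ?I)" by (simp add: LIM_zero_iff)
  qed
  then have "continuous_on ?I (\<lambda>s. \<psi> (norm (u s)) - s)"
    by (intro continuous_intros continuous_on_compose2[OF cont]) auto
  then have "connected ((\<lambda>s. \<psi> (norm (u s)) - s) ` ?I)"
    by (intro connected_continuous_image) auto
  moreover have "u s\<^sub>1 = u\<^sub>1" "u s\<^sub>2 = u\<^sub>2" using uniq p q by force+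
  then have "\<psi> (norm (u s\<^sub>2)) - s\<^sub>2 \<le> 0" "0 \<le> \<psi> (norm (u s\<^sub>1)) - s\<^sub>1" using p q by auto
  ultimately have "0 \<in> (\<lambda>s. \<psi> (norm (u s)) - s) ` ?I"
    unfolding connected_iff_interval by (meson ends_in_segment imageI)
  then obtain s where "s \<in> ?I" "\<psi> (norm (u s)) = s" by auto
  then show ?thesis using u[of s] by force
qed

text \<open>
  The end of the interval is \<open>b = Inf S\<close>, where \<open>- S\<close> is the negative part of the spectrum. Since the
  spectrum is closed, \<open>b\<close> belongs to \<open>S\<close>, and the assumption on isolated points makes \<open>- b\<close> an
  eigenvalue.
\<close>

theorem exists_solution:
  assumes d: "d > 0"
    and gap: "\<And>s. \<lbrakk>0 < s; s < d\<rbrakk> \<Longrightarrow> bounded_below_on D (\<lambda>u. A u + s *\<^sub>R u)"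
    and isol: "\<And>s. \<lbrakk>s > 0; \<not> bounded_below_on D (\<lambda>u. A u + s *\<^sub>R u)\<rbrakk> \<Longrightarrow>
      \<exists>\<epsilon>>0. \<forall>r. r \<noteq> s \<longrightarrow> \<bar>r - s\<bar> < \<epsilon> \<longrightarrow> bounded_below_on D (\<lambda>u. A u + r *\<^sub>R u)"
    and cont: "continuous_on {0..} \<psi>"
    and nonneg: "\<And>t. t \<ge> 0 \<Longrightarrow> \<psi> t \<ge> 0"
    and large: "\<forall>\<^sub>F t in at_top. norm h \<le> \<psi> t * t"
    and lim: "(\<psi> \<longlongrightarrow> 0) at_top"
  shows "\<exists>u\<in>D. A u + \<psi> (norm u) *\<^sub>R u = h"
proof (rule ccontr)
  assume none: "\<not> ?thesis"
  define S where "S = {s. s > 0 \<and> \<not> bounded_below_on D (\<lambda>u. A u + s *\<^sub>R u)}"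
  have dS: "d \<le> s" if "s \<in> S" for s
    using that gap[of s] by (auto simp: S_def not_le[symmetric])
  obtain s\<^sub>1 u\<^sub>1 where p: "0 < s\<^sub>1" "s\<^sub>1 < d" "u\<^sub>1 \<in> D" "A u\<^sub>1 + s\<^sub>1 *\<^sub>R u\<^sub>1 = h" "s\<^sub>1 \<le> \<psi> (norm u\<^sub>1)"
    using solution_at_zero_end[OF d gap cont nonneg large] none by blast
  have fin: False
    if q: "0 < s\<^sub>2" "u\<^sub>2 \<in> D" "A u\<^sub>2 + s\<^sub>2 *\<^sub>R u\<^sub>2 = h" "\<psi> (norm u\<^sub>2) \<le> s\<^sub>2"
      and below: "\<And>s. s \<in> S \<Longrightarrow> s\<^sub>2 < s" for s\<^sub>2 u\<^sub>2
  proof -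
    have "bounded_below_on D (\<lambda>u. A u + s *\<^sub>R u)" if s: "s \<in> closed_segment s\<^sub>1 s\<^sub>2" for s
    proof -
      have "0 < s" "s \<le> max s\<^sub>1 s\<^sub>2"
        using s p(1) q(1) by (auto simp: closed_segment_eq_real_ivl split: if_splits)
      then have "s \<notin> S" using below[of s] dS[of s] p(2) by (auto simp: max_def split: if_splits)
      then show ?thesis using \<open>0 < s\<close> by (simp add: S_def)
    qed
    then show False using solution_between[OF p(3-5) q(2-4) _ cont] none by blast
  qed
  show False
  proof (cases "S = {}")
    case True
    then obtain s\<^sub>2 u\<^sub>2 where "0 < s\<^sub>2" "u\<^sub>2 \<in> D" "A u\<^sub>2 + s\<^sub>2 *\<^sub>R u\<^sub>2 = h" "\<psi> (norm u\<^sub>2) \<le> s\<^sub>2"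
      using solution_at_infinite_end[OF _ cont, of h] by (auto simp: S_def)
    then show False using fin True by blast
  next
    case False
    define b where "b = Inf S"
    have bdd: "bdd_below S" using dS by (rule bdd_belowI)
    have bd: "d \<le> b" unfolding b_def using False dS by (rule cInf_greatest)
    have b_le: "b \<le> s" if "s \<in> S" for s unfolding b_def by (rule cInf_lower[OF that bdd])
    have bS: "b \<in> S"
    proof (rule ccontr)
      assume "b \<notin> S"
      then have "bounded_below_on D (\<lambda>u. A u + b *\<^sub>R u)" using bd d by (auto simp: S_def)
      then obtain \<eta> where \<eta>: "\<eta> > 0"
        "\<And>r. \<bar>r\<bar> < \<eta> \<Longrightarrow> bounded_below_on D (\<lambda>u. A u + b *\<^sub>R u + r *\<^sub>R u)"
        using real_self_adjoint.bounded_below_open[OF shift] by blast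
      obtain s where s: "s \<in> S" "s < b + \<eta>"
        using cInf_lessD[OF False, of "b + \<eta>"] \<eta>(1) by (auto simp: b_def)
      have "bounded_below_on D (\<lambda>u. A u + b *\<^sub>R u + (s - b) *\<^sub>R u)"
        using s b_le[OF s(1)] by (intro \<eta>(2)) auto
      then show False using s(1) by (simp add: S_def algebra_simps)
    qed
    then obtain \<epsilon> where \<epsilon>: "\<epsilon> > 0"
      "\<And>r. \<lbrakk>r \<noteq> b; \<bar>r - b\<bar> < \<epsilon>\<rbrakk> \<Longrightarrow> bounded_below_on D (\<lambda>u. A u + r *\<^sub>R u)"
      using isol[of b] by (auto simp: S_def)
    have "\<exists>e\<in>D. e \<noteq> 0 \<and> A e + b *\<^sub>R e = 0"
    proof (rule real_self_adjoint.isolated_imp_eigenvalue[OF shift \<epsilon>(1)])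
      fix r :: real assume "r \<noteq> 0" "\<bar>r\<bar> < \<epsilon>"
      then show "bounded_below_on D (\<lambda>u. A u + b *\<^sub>R u + r *\<^sub>R u)"
        using \<epsilon>(2)[of "b + r"] by (simp add: scaleR_add_left add.assoc)
    qed (use bS in \<open>simp add: S_def\<close>)
    then obtain e where e: "e \<in> D" "e \<noteq> 0" "A e + b *\<^sub>R e = 0" by blast
    have "bounded_below_on D (\<lambda>u. A u + s *\<^sub>R u)" if "0 < s" "s < b" for s
      using b_le[of s] that by (auto simp: S_def)
    then obtain s\<^sub>2 u\<^sub>2 where "0 < s\<^sub>2" "s\<^sub>2 < b" "u\<^sub>2 \<in> D" "A u\<^sub>2 + s\<^sub>2 *\<^sub>R u\<^sub>2 = h" "\<psi> (norm u\<^sub>2) \<le> s\<^sub>2"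
      using solution_at_eigenvalue_end[OF _ _ e cont lim, of h] bd d none by force
    then show False using fin b_le by force
  qed
qed

end

section \<open>Passage from complex to real Hilbert spaces\<close>

text \<open>
  The imaginary part of \<open>cinner x y\<close> is minus the real inner product of \<open>\<i> x\<close> and \<open>y\<close>, so the real
  identities for \<open>u\<close> and \<open>\<i> u\<close> amount to the complex identity for \<open>u\<close>.
\<close>

lemma cinner_eq_iff_inner:
  fixes D :: "'a::complex_inner set"
  assumes lin: "linear_operator_on D L"
  shows "(\<forall>u\<in>D. cinner (L u) v = cinner u w) \<longleftrightarrow> (\<forall>u\<in>D. L u \<bullet> v = u \<bullet> w)"
proof
  assume "\<forall>u\<in>D. cinner (L u) v = cinner u w"
  then show "\<forall>u\<in>D. L u \<bullet> v = u \<bullet> w" by (simp add: Re_cinner[symmetric])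
next
  assume re: "\<forall>u\<in>D. L u \<bullet> v = u \<bullet> w"
  have Im: "Im (cinner x y) = - ((\<i> *\<^sub>C x) \<bullet> y)" for x y :: 'a
    by (simp add: Re_cinner[symmetric] cinner_scaleC_left)
  show "\<forall>u\<in>D. cinner (L u) v = cinner u w"
  proof
    fix u assume u: "u \<in> D"
    then have "\<i> *\<^sub>C u \<in> D" "L (\<i> *\<^sub>C u) = \<i> *\<^sub>C L u"
      using lin by (auto simp: linear_operator_on_def complex_vector.subspace_scale)
    then have "(\<i> *\<^sub>C L u) \<bullet> v = (\<i> *\<^sub>C u) \<bullet> w" using re by metis
    then show "cinner (L u) v = cinner u w"
      using re u by (intro complex_eqI) (simp_all add: Re_cinner Im)
  qed
qed

lemma self_adjoint_imp_real_self_adjoint: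
  fixes D :: "'a::chilbert_space set"
  assumes "self_adjoint D L"
  shows "real_self_adjoint D L"
proof -
  have lin: "linear_operator_on D L" and dense: "closure D = UNIV"
    and dom: "adjoint_domain D L = D" and adj: "\<And>v. v \<in> D \<Longrightarrow> adjoint_operator D L v = L v"
    using assms by (auto simp: self_adjoint_def)
  have uniq: "w = w'" if "\<forall>u\<in>D. L u \<bullet> v = u \<bullet> w" "\<forall>u\<in>D. L u \<bullet> v = u \<bullet> w'" for v w w'
  proof -
    have "w - w' = 0"
      by (rule dense_orthogonal_eq_0[OF dense]) (use that in \<open>simp add: inner_diff_right\<close>)
    then show ?thesis by simp
  qed
  have char: "v \<in> D \<and> L v = w \<longleftrightarrow> (\<forall>u\<in>D. L u \<bullet> v = u \<bullet> w)" for v w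
  proof -
    have L: "L v = w" if "v \<in> D" "\<forall>u\<in>D. L u \<bullet> v = u \<bullet> w" for v w
    proof -
      have "adjoint_operator D L v = w"
        unfolding adjoint_operator_def cinner_eq_iff_inner[OF lin]
        using that(2) uniq by (intro the_equality) blast+
      then show ?thesis using adj that(1) by simp
    qed
    have "v \<in> D \<longleftrightarrow> (\<exists>w. \<forall>u\<in>D. L u \<bullet> v = u \<bullet> w)" for v
      using dom by (auto simp: adjoint_domain_def cinner_eq_iff_inner[OF lin])
    then show ?thesis using L by metis
  qed
  have sub: "subspace D"
    using lin unfolding linear_operator_on_def subspace_def complex_vector.subspace_def
    by (metis scaleC_of_real)
  show ?thesis
  proof
    show "L (r *\<^sub>R u) = r *\<^sub>R L u" if "u \<in> D" for r u
      using lin that unfolding linear_operator_on_def by (metis scaleC_of_real)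
  qed (use lin char sub in \<open>auto simp: linear_operator_on_def\<close>)
qed

text \<open>
  The left-to-right direction is the boundedness of the inverse; conversely, bijectivity comes from
  \<open>bounded_below_surj\<close>.
\<close>

lemma resolvent_set_iff_bounded_below:
  assumes "real_self_adjoint D L"
  shows "complex_of_real (- s) \<in> resolvent_set D L \<longleftrightarrow> bounded_below_on D (\<lambda>u. L u + s *\<^sub>R u)"
proof -
  define T where "T = (\<lambda>u. L u + s *\<^sub>R u)"
  interpret T: real_self_adjoint D T
    unfolding T_def by (rule real_self_adjoint.shift[OF assms])
  have "L u - complex_of_real (- s) *\<^sub>C u = T u" for u
    using scaleC_of_real[of "- s" u] by (simp add: T_def)
  then have res: "complex_of_real (- s) \<in> resolvent_set D L \<longleftrightarrow>
      bij_betw T D UNIV \<and> bounded_linear (inv_into D T)"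
    unfolding resolvent_set_def by simp
  have "bounded_below_on D T" if bij: "bij_betw T D UNIV" and lin: "bounded_linear (inv_into D T)"
  proof -
    obtain K where K: "K > 0" "\<And>x. norm (inv_into D T x) \<le> norm x * K"
      using bounded_linear.pos_bounded[OF lin] by blast
    have "(1 / K) * norm u \<le> norm (T u)" if "u \<in> D" for u
      using K(2)[of "T u"] K(1) bij_betw_inv_into_left[OF bij that] by (simp add: field_simps)
    then show ?thesis unfolding bounded_below_on_def using K(1)
      by (intro exI[of _ "1/K"]) auto
  qed
  moreover have "bij_betw T D UNIV \<and> bounded_linear (inv_into D T)" if bb: "bounded_below_on D T"
  proof -
    obtain c where c: "c > 0" "\<And>u. u \<in> D \<Longrightarrow> c * norm u \<le> norm (T u)"
      using bounded_below_onE[OF bb] by blast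
    have inj: "inj_on T D"
    proof (rule inj_onI)
      fix x y assume "x \<in> D" "y \<in> D" "T x = T y"
      then show "x = y"
        using c(2)[OF T.domain_diff[of x y]] c(1) by (simp add: T.diff mult_le_0_iff)
    qed
    have surj: "T ` D = UNIV" using T.bounded_below_surj[OF bb] by (metis UNIV_eq_I image_eqI)
    have inv: "inv_into D T x \<in> D" "T (inv_into D T x) = x" for x
      using surj by (auto simp: inv_into_into f_inv_into_f)
    have "bounded_linear (inv_into D T)"
    proof (rule bounded_linear_intro[where K = "1 / c"])
      show "inv_into D T (x + y) = inv_into D T x + inv_into D T y" for x y
        by (rule inj_onD[OF inj]) (auto simp: inv T.add T.domain_add)
      show "inv_into D T (r *\<^sub>R x) = r *\<^sub>R inv_into D T x" for r x
        by (rule inj_onD[OF inj]) (auto simp: inv T.scale T.domain_scale)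
      show "norm (inv_into D T x) \<le> norm x * (1 / c)" for x
        using c(2)[OF inv(1)[of x]] c(1) by (simp add: inv field_simps)
    qed
    then show ?thesis using inj surj by (simp add: bij_betw_def)
  qed
  ultimately show ?thesis using res unfolding T_def by blast
qed

lemma real_Inf_le:
  assumes "complex_of_real x \<in> S"
  shows "real_Inf S \<le> ereal x"
  unfolding real_Inf_def using assms by (intro Inf_lower) auto

section \<open>The nonlinear equation\<close>

theorem theorem2p11:
  fixes D :: "'a::chilbert_space set"
    and L :: "'a \<Rightarrow> 'a"
    and h :: 'a
    and \<phi> :: "real \<Rightarrow> real"
    and \<gamma> \<delta> :: real
  assumes separable: "separable_space (euclidean :: 'a topology)"
    and self_adjoint: "self_adjoint D L"
    and a: "real_Inf (essential_spectrum D L) = 0"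
    and b: "\<delta> > 0" "complex_of_real ` {-\<delta><..<0} \<subseteq> resolvent_set D L"
    and c: "\<gamma> \<ge> 0" "real_Inf (spectrum D L) = ereal (- \<gamma>)"
    and phi_nonneg: "\<And>t. t \<ge> 0 \<Longrightarrow> \<phi> t \<ge> 0"
    and phi_cont: "continuous_on {0..} \<phi>"
    and i: "((\<lambda>t. (\<phi> t)\<^sup>2 / t) \<longlongrightarrow> 0) at_top"
    and ii: "Liminf at_top (\<lambda>t. ereal (\<phi> t)) > ereal (norm h)"
  shows "\<exists>u\<in>D. L u + nonlinearity \<phi> u = h"
proof -
  interpret real_self_adjoint D L by (rule self_adjoint_imp_real_self_adjoint[OF self_adjoint])
  note res = resolvent_set_iff_bounded_below[OF real_self_adjoint_axioms]
  define \<psi> where "\<psi> t = \<phi> t / max 1 t" for t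
  have N: "nonlinearity \<phi> u = \<psi> (norm u) *\<^sub>R u" for u :: 'a
    by (auto simp: nonlinearity_def proj_ball_def \<psi>_def max_def divide_inverse)
  have "\<exists>u\<in>D. L u + \<psi> (norm u) *\<^sub>R u = h"
  proof (rule exists_solution[OF b(1)])
    fix s :: real assume "0 < s" "s < \<delta>"
    then have "complex_of_real (- s) \<in> complex_of_real ` {-\<delta><..<0}" by (intro imageI) simp
    then show "bounded_below_on D (\<lambda>u. L u + s *\<^sub>R u)" using b(2) res by blast
  next
    fix s :: real assume s: "s > 0" "\<not> bounded_below_on D (\<lambda>u. L u + s *\<^sub>R u)"
    have "complex_of_real (- s) \<notin> essential_spectrum D L"
    proof
      assume "complex_of_real (- s) \<in> essential_spectrum D L"
      from real_Inf_le[OF this] have "(0::ereal) \<le> ereal (- s)" using a by simp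
      then show False using s(1) by simp
    qed
    moreover have "complex_of_real (- s) \<in> spectrum D L" using s(2) res by (simp add: spectrum_def)
    ultimately have "\<not> complex_of_real (- s) islimpt spectrum D L"
      by (simp add: essential_spectrum_def)
    then obtain \<epsilon> where \<epsilon>: "\<epsilon> > 0"
      "\<And>z. \<lbrakk>z \<in> spectrum D L; dist z (complex_of_real (- s)) < \<epsilon>\<rbrakk> \<Longrightarrow> z = complex_of_real (- s)"
      unfolding islimpt_approachable by blast
    have "bounded_below_on D (\<lambda>u. L u + r *\<^sub>R u)" if "r \<noteq> s" "\<bar>r - s\<bar> < \<epsilon>" for r
    proof -
      have "dist (complex_of_real (- r)) (complex_of_real (- s)) < \<epsilon>"
        using that(2) by (simp only: dist_of_real) (simp add: dist_real_def)
      then have "complex_of_real (- r) \<notin> spectrum D L"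
        using \<epsilon>(2)[of "complex_of_real (- r)"] that(1) by (auto simp del: of_real_minus)
      then show ?thesis using res[of r] by (simp add: spectrum_def)
    qed
    then show "\<exists>\<epsilon>>0. \<forall>r. r \<noteq> s \<longrightarrow> \<bar>r - s\<bar> < \<epsilon> \<longrightarrow> bounded_below_on D (\<lambda>u. L u + r *\<^sub>R u)"
      using \<epsilon>(1) by blast
  next
    show "continuous_on {0..} \<psi>"
      unfolding \<psi>_def by (intro continuous_intros phi_cont) (auto simp: max_def)
    show "\<psi> t \<ge> 0" if "t \<ge> 0" for t using phi_nonneg[OF that] by (simp add: \<psi>_def)
    have "\<forall>\<^sub>F t in at_top. ereal (norm h) < ereal (\<phi> t)" using less_LiminfD[OF ii] .
    then show "\<forall>\<^sub>F t in at_top. norm h \<le> \<psi> t * t"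
      using eventually_ge_at_top[of 1] by eventually_elim (simp add: \<psi>_def max_def)
    show "(\<psi> \<longlongrightarrow> 0) at_top"
    proof (rule tendsto_sandwich)
      show "\<forall>\<^sub>F t in at_top. 0 \<le> \<psi> t"
        using eventually_ge_at_top[of 0] by eventually_elim (simp add: \<psi>_def phi_nonneg)
      show "\<forall>\<^sub>F t in at_top. \<psi> t \<le> (\<phi> t)\<^sup>2 / t + inverse t"
        using eventually_ge_at_top[of 1]
      proof eventually_elim
        fix t :: real assume t: "1 \<le> t"
        \<comment> \<open>\<open>\<phi> \<le> \<phi>\<^sup>2 + 1\<close> turns the hypothesis on \<open>\<phi>\<^sup>2\<close> into one on \<open>\<phi>\<close>.\<close>
        have "0 \<le> (\<phi> t - 1/2)\<^sup>2" by simp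
        then have "\<phi> t \<le> (\<phi> t)\<^sup>2 + 1" by (simp add: power2_eq_square algebra_simps)
        then have "\<phi> t / t \<le> ((\<phi> t)\<^sup>2 + 1) / t" using t by (intro divide_right_mono) auto
        then show "\<psi> t \<le> (\<phi> t)\<^sup>2 / t + inverse t"
          using t by (simp add: \<psi>_def max_def add_divide_distrib divide_inverse algebra_simps)
      qed
      show "((\<lambda>t. (\<phi> t)\<^sup>2 / t + inverse t) \<longlongrightarrow> 0) at_top"
        using tendsto_add[OF i tendsto_inverse_0_at_top[OF filterlim_ident]] by simp
    qed simp
  qed
  then show ?thesis by (simp add: N)
qed

end
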